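(* For every bivariate copula $C$, every $\alpha\in[0,1]$ and every $p\in[1,+\infty]$, the copula $C_\alpha=\alpha C+(1-\alpha)C^t$ satisfies $$\mu_p(C_\alpha)\;=\;|2\alpha-1|\,\mu_p(C).$$
   Context: A (bivariate) copula is a function $C:[0,1]^2\to[0,1]$ with $C(t,0)=C(0,t)=0$, $C(t,1)=C(1,t)=t$ for all $t\in[0,1]$, and $C(u',v')-C(u,v')-C(u',v)+C(u,v)\ge 0$ whenever $u\le u'$, $v\le v'$ in $[0,1]$. The transpose is $C^t(u,v)=C(v,u)$. For $p\in[1,\infty)$, $\mu_p(C)=\left(\int_{[0,1]^2}|C(u,v)-C(v,u)|^p\,du\,dv\right)^{1/p}$, and $\mu_\infty(C)=\sup_{(u,v)\in[0,1]^2}|C(u,v)-C(v,u)|$. *)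

theory Defs
  imports "HOL-Analysis.Analysis"
begin

(* A copula is represented by a curried function on the reals of which only the values on the
   unit square matter: no definition below inspects C outside [0,1] x [0,1]. *)
definition is_copula :: "(real \<Rightarrow> real \<Rightarrow> real) \<Rightarrow> bool" where
  "is_copula C \<longleftrightarrow>
     (\<forall>u\<in>{0..1}. \<forall>v\<in>{0..1}. C u v \<in> {0..1}) \<and>
     (\<forall>t\<in>{0..1}. C t 0 = 0 \<and> C 0 t = 0) \<and>
     (\<forall>t\<in>{0..1}. C t 1 = t \<and> C 1 t = t) \<and>
     (\<forall>u\<in>{0..1}. \<forall>u'\<in>{0..1}. \<forall>v\<in>{0..1}. \<forall>v'\<in>{0..1}.
        u \<le> u' \<longrightarrow> v \<le> v' \<longrightarrow> C u' v' - C u v' - C u' v + C u v \<ge> 0)"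

definition copula_transpose :: "(real \<Rightarrow> real \<Rightarrow> real) \<Rightarrow> real \<Rightarrow> real \<Rightarrow> real" where
  "copula_transpose C = (\<lambda>u v. C v u)"

definition copula_mix :: "real \<Rightarrow> (real \<Rightarrow> real \<Rightarrow> real) \<Rightarrow> real \<Rightarrow> real \<Rightarrow> real" where
  "copula_mix \<alpha> C = (\<lambda>u v. \<alpha> * C u v + (1 - \<alpha>) * copula_transpose C u v)"

(* Intended for 1 \<le> p \<le> \<infinity>.  For a copula C the integrand is continuous and bounded on the unit
   square, so the Lebesgue integral and the real-valued supremum are the genuine ones.
   Since p > 0, the library convention 0 powr p = 0 is the usual one. *)
definition asym_measure :: "ereal \<Rightarrow> (real \<Rightarrow> real \<Rightarrow> real) \<Rightarrow> real" where
  "asym_measure p C =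
     (if p = \<infinity> then (SUP (u, v)\<in>{0..1} \<times> {0..1}. \<bar>C u v - C v u\<bar>)
      else (set_lebesgue_integral lborel ({0..1} \<times> {0..1})
              (\<lambda>(u, v). \<bar>C u v - C v u\<bar> powr real_of_ereal p)) powr (1 / real_of_ereal p))"

end

theory Submission
  imports Defs
begin

text \<open>Transposing swaps the weights \<alpha> and 1 - \<alpha>, so the asymmetry C(u,v) -
  C(v,u) of the mixture is, pointwise, that of C times \<alpha> - (1 - \<alpha>) = 2\<alpha> - 1
  (\<open>abs_copula_mix_diff\<close>). Suprema and L^p norms are absolutely homogeneous, so the
  factor comes out as |2\<alpha> - 1| (\<open>asym_measure_copula_mix\<close>). The mixture is a
  copula because the defining conditions survive transposition and convex combination
  (\<open>is_copula_mix\<close>).\<close>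

lemma is_copula_mix:
  assumes C: "is_copula C" and \<alpha>: "\<alpha> \<in> {0..1}"
  shows "is_copula (copula_mix \<alpha> C)"
proof -
  have range: "C u v \<in> {0..1}" if "u \<in> {0..1}" "v \<in> {0..1}" for u v
    using C that unfolding is_copula_def by blast
  have zero: "C t 0 = 0" "C 0 t = 0" and one: "C t 1 = t" "C 1 t = t" if "t \<in> {0..1}" for t
    using C that unfolding is_copula_def by blast+
  have incr: "C u' v' - C u v' - C u' v + C u v \<ge> 0"
    if "u \<in> {0..1}" "u' \<in> {0..1}" "v \<in> {0..1}" "v' \<in> {0..1}" "u \<le> u'" "v \<le> v'" for u u' v v'
    using C that unfolding is_copula_def by blast
  have "\<alpha> * C u v + (1 - \<alpha>) * C v u \<in> {0..1}" if "u \<in> {0..1}" "v \<in> {0..1}" for u v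
    using convexD[OF convex_real_interval(5), of "C u v" 0 1 "C v u" \<alpha> "1 - \<alpha>"]
      range[OF that] range[OF that(2,1)] \<alpha> by simp
  moreover have "(\<alpha> * C u' v' + (1 - \<alpha>) * C v' u') - (\<alpha> * C u v' + (1 - \<alpha>) * C v' u)
      - (\<alpha> * C u' v + (1 - \<alpha>) * C v u') + (\<alpha> * C u v + (1 - \<alpha>) * C v u) \<ge> 0"
    if "u \<in> {0..1}" "u' \<in> {0..1}" "v \<in> {0..1}" "v' \<in> {0..1}" "u \<le> u'" "v \<le> v'" for u u' v v'
  proof -
    have "0 \<le> \<alpha> * (C u' v' - C u v' - C u' v + C u v)
      + (1 - \<alpha>) * (C v' u' - C v u' - C v' u + C v u)"
      \<comment> \<open>The second instance is the C-volume of the rectangle reflected in the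
        diagonal.\<close>
      using incr[OF that] incr[OF that(3,4,1,2,6,5)] \<alpha> by simp
    then show ?thesis by (simp add: algebra_simps)
  qed
  ultimately show ?thesis
    unfolding is_copula_def copula_mix_def copula_transpose_def
    by (auto simp: zero one algebra_simps)
qed

lemma abs_copula_mix_diff:
  "\<bar>copula_mix \<alpha> C u v - copula_mix \<alpha> C v u\<bar> = \<bar>2 * \<alpha> - 1\<bar> * \<bar>C u v - C v u\<bar>"
  unfolding copula_mix_def copula_transpose_def abs_mult[symmetric]
  by (simp add: algebra_simps)

text \<open>Multiplication by c \<ge> 0 is monotone and continuous, hence commutes with the supremum
  of a nonempty bounded set.\<close>

lemma cSUP_mult_left_real:
  fixes f :: "'a \<Rightarrow> real"
  assumes "c \<ge> 0" "A \<noteq> {}" "bdd_above (f ` A)"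
  shows "(SUP x\<in>A. c * f x) = c * (SUP x\<in>A. f x)"
  using continuous_at_Sup_mono[of "(*) c" "f ` A"] assms
  by (simp add: mono_def mult_left_mono image_image continuous_intros)

text \<open>Makes the real-valued supremum genuine for p = \<infinity>: two values in [0,1] differ
  by at most 1.\<close>

lemma bdd_above_copula_diff:
  assumes "is_copula C"
  shows "bdd_above ((\<lambda>(u, v). \<bar>C u v - C v u\<bar>) ` ({0..1} \<times> {0..1}))"
proof (rule bdd_aboveI2[where M = 1], clarify)
  fix u v :: real
  assume "u \<in> {0..1}" "v \<in> {0..1}"
  then have "C u v \<in> {0..1}" "C v u \<in> {0..1}"
    using assms unfolding is_copula_def by blast+
  then show "\<bar>C u v - C v u\<bar> \<le> 1" by auto
qed

lemma asym_measure_copula_mix: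
  assumes C: "is_copula C" and p: "0 < p"
  shows "asym_measure p (copula_mix \<alpha> C) = \<bar>2 * \<alpha> - 1\<bar> * asym_measure p C"
proof (cases "p = \<infinity>")
  case True
  then show ?thesis
    using cSUP_mult_left_real[OF _ _ bdd_above_copula_diff[OF C], of "\<bar>2 * \<alpha> - 1\<bar>"]
    by (simp add: asym_measure_def abs_copula_mix_diff split_def)
next
  case False
  define c where "c = \<bar>2 * \<alpha> - 1\<bar>"
  define r where "r = real_of_ereal p"
  define I where "I = set_lebesgue_integral lborel ({0..1} \<times> {0..1})
    (\<lambda>(u, v). \<bar>C u v - C v u\<bar> powr r)"
  \<comment> \<open>Finiteness of p matters: \<open>real_of_ereal\<close> sends \<infinity> to
    0.\<close>
  have r: "r > 0" using False p unfolding r_def by (cases p) auto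
  have "I \<ge> 0"
    unfolding I_def set_lebesgue_integral_def by (auto intro!: integral_nonneg simp: split_def)
  \<comment> \<open>Constants pass through the Bochner integral unconditionally, since a
    non-integrable function has integral 0; so no measurability of C has to be shown.\<close>
  have "asym_measure p (copula_mix \<alpha> C) = (c powr r * I) powr (1 / r)"
    using False
    by (simp add: asym_measure_def abs_copula_mix_diff I_def powr_mult split_def
        flip: c_def r_def set_integral_mult_right)
  \<comment> \<open>The root splits over the product since both factors are nonnegative, and r > 0
    turns \<open>(c powr r) powr (1 / r)\<close> into c, also for c = 0 (\<alpha> = 1/2).\<close>
  also have "\<dots> = c * I powr (1 / r)"
    using r \<open>I \<ge> 0\<close> by (simp add: powr_mult powr_powr c_def)
  finally show ?thesis
    using False by (simp add: asym_measure_def I_def c_def r_def)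
qed

theorem proposition5:
  fixes C :: "real \<Rightarrow> real \<Rightarrow> real" and \<alpha> :: real and p :: ereal
  assumes "is_copula C"
    and "\<alpha> \<in> {0..1}"
    and "1 \<le> p"
  shows "is_copula (copula_mix \<alpha> C) \<and>
         asym_measure p (copula_mix \<alpha> C) = \<bar>2 * \<alpha> - 1\<bar> * asym_measure p C"
proof -
  have "0 < p" using assms(3) by (rule less_le_trans[rotated]) simp
  then show ?thesis
    using is_copula_mix[OF assms(1,2)] asym_measure_copula_mix[OF assms(1)] by blast
qed

end
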